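(* Let $n\ge 2$ and $q>0$. There is no $u\in C^{6}(\mathbb{R}^{n})$ with $u>0$ solving $\Delta^{3}u=u^{-q}$ in $\mathbb{R}^{n}$ and satisfying $u(x)=o(|x|^{6/(q+1)})$ as $|x|\to+\infty$. Moreover, there is no radially symmetric such solution $u=u(r)$ satisfying $\limsup_{r\to+\infty}u(r)/r^{6/(q+1)}<+\infty$ and $\liminf_{r\to+\infty}u(r)/r^{6/(q+1)}=0$. *)

theory Defs
  imports "HOL-Analysis.Analysis" "HOL-Library.Landau_Symbols"
begin

definition partial :: "'n::finite \<Rightarrow> (real^'n \<Rightarrow> real) \<Rightarrow> real^'n \<Rightarrow> real" where
  "partial i f x = deriv (\<lambda>t. f (x + t *\<^sub>R axis i 1)) 0"

fun Ck :: "nat \<Rightarrow> (real^'n::finite \<Rightarrow> real) \<Rightarrow> bool" where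
  "Ck 0 f = continuous_on UNIV f"
| "Ck (Suc k) f = (continuous_on UNIV f \<and>
     (\<forall>i. (\<forall>x. (\<lambda>t. f (x + t *\<^sub>R axis i 1)) differentiable (at 0)) \<and> Ck k (partial i f)))"

definition laplacian :: "(real^'n::finite \<Rightarrow> real) \<Rightarrow> real^'n \<Rightarrow> real" where
  "laplacian f x = (\<Sum>i\<in>UNIV. partial i (partial i f) x)"

end

theory Submission
  imports Defs
begin

text \<open>
  Write \<alpha> = 6 / (q + 1), so that \<alpha> q = 6 - \<alpha>. Testing the equation, rescaled by R, against a fixed
  bump function supported in the annulus 1/2 \<le> |x| \<le> 1 shows that u \<le> \<epsilon> R^\<alpha> on the annulus
  R/2 \<le> |x| \<le> R forces \<epsilon> to exceed a constant independent of u and R: the right-hand side is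
  at least of order \<epsilon>^(-q) R^(\<alpha> - 6), while moving the derivatives onto the bump function bounds the
  left-hand side by a multiple of \<epsilon> R^(\<alpha> - 6). This excludes solutions that are o(|x|^\<alpha>).

  A radial solution is eventually nondecreasing in r. Indeed, the bilaplacian of u is increasing, because its
  Laplacian is positive. If it is positive somewhere, then \<Delta>u tends to infinity and u' is eventually
  positive. Otherwise it is negative everywhere, so \<Delta>u is decreasing; \<Delta>u cannot become negative
  because u would then tend to minus infinity, and so \<Delta>u > 0 and u is increasing. Hence smallness of
  u(r) / r^\<alpha> at a single large radius r propagates to the whole annulus r/2 \<le> |x| \<le> r.
\<close>

section \<open>Partial derivatives and the classes \<open>Ck\<close>\<close>

lemma DERIV_partial:
  assumes "(\<lambda>t. f (x + t *\<^sub>R axis i 1)) differentiable (at 0)"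
  shows "((\<lambda>t. f (x + t *\<^sub>R axis i 1)) has_real_derivative partial i f x) (at 0)"
  using assms unfolding partial_def by (simp add: DERIV_deriv_iff_real_differentiable)

lemma partialI:
  assumes "((\<lambda>t. f (x + t *\<^sub>R axis i 1)) has_real_derivative D) (at 0)"
  shows "(\<lambda>t. f (x + t *\<^sub>R axis i 1)) differentiable (at 0)" and "partial i f x = D"
  using assms unfolding partial_def by (auto simp: real_differentiable_def DERIV_imp_deriv)

text \<open>Since the hypothesis holds at every base point, moving the base point to
  \<open>x + s *\<^sub>R e\<close> turns the parameter \<open>s\<close> into 0.\<close>

lemma DERIV_line:
  fixes f :: "'a::real_vector \<Rightarrow> real"
  assumes "\<And>x. ((\<lambda>t. f (x + t *\<^sub>R e)) has_real_derivative f' x) (at 0)"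
  shows "((\<lambda>t. f (x + t *\<^sub>R e)) has_real_derivative f' (x + s *\<^sub>R e)) (at s)"
proof -
  have "((\<lambda>t. f (x + (t + s) *\<^sub>R e)) has_real_derivative f' (x + s *\<^sub>R e)) (at 0)"
    using assms[of "x + s *\<^sub>R e"] by (simp add: algebra_simps)
  then show ?thesis
    using DERIV_shift[of "\<lambda>t. f (x + t *\<^sub>R e)" _ 0 s] by simp
qed

lemma Ck_imp_continuous: "Ck k f \<Longrightarrow> continuous_on UNIV f"
  by (cases k) auto

lemma Ck_DERIV:
  assumes "Ck (Suc k) f"
  shows "((\<lambda>t. f (x + t *\<^sub>R axis i 1)) has_real_derivative partial i f x) (at 0)"
  using assms by (intro DERIV_partial) auto

text \<open>Uniqueness of derivatives identifies \<open>f' i\<close> with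
  \<open>partial i f\<close>, so regularity can be proved from explicit derivative formulas.\<close>

lemma Ck_SucI:
  assumes "continuous_on UNIV f"
    and "\<And>i x. ((\<lambda>t. f (x + t *\<^sub>R axis i 1)) has_real_derivative f' i x) (at 0)"
    and "\<And>i. Ck k (f' i)"
  shows "Ck (Suc k) f"
proof -
  have "partial i f = f' i" for i
    using partialI(2)[OF assms(2)] by auto
  then show ?thesis
    using assms partialI(1)[OF assms(2)] by auto
qed

lemma Ck_Suc_imp_Ck: "Ck (Suc k) f \<Longrightarrow> Ck k f"
  by (induction k arbitrary: f) auto

lemma Ck_mono: "Ck m f \<Longrightarrow> k \<le> m \<Longrightarrow> Ck k f"
  by (induction m) (auto simp: le_Suc_eq dest: Ck_Suc_imp_Ck simp del: Ck.simps)

lemma Ck_zero: "Ck k (\<lambda>x. 0)"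
proof (induction k)
  case (Suc k)
  show ?case by (rule Ck_SucI[where f' = "\<lambda>i x. 0"]) (auto intro: Suc)
qed auto

lemma Ck_add:
  assumes "Ck k f" "Ck k g"
  shows "Ck k (\<lambda>x. f x + g x)"
  using assms
proof (induction k arbitrary: f g)
  case 0
  then show ?case by (auto intro: continuous_intros)
next
  case (Suc k)
  show ?case
  proof (rule Ck_SucI)
    show "continuous_on UNIV (\<lambda>x. f x + g x)"
      using Suc.prems by (intro continuous_intros) (auto dest: Ck_imp_continuous)
    show "((\<lambda>t. f (x + t *\<^sub>R axis i 1) + g (x + t *\<^sub>R axis i 1)) has_real_derivative
        partial i f x + partial i g x) (at 0)" for i x
      by (intro DERIV_add Suc.prems[THEN Ck_DERIV])
    show "Ck k (\<lambda>x. partial i f x + partial i g x)" for i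
      using Suc.prems by (intro Suc.IH) auto
  qed
qed

lemma Ck_sum:
  assumes "\<And>i. i \<in> A \<Longrightarrow> Ck k (f i)"
  shows "Ck k (\<lambda>x. \<Sum>i\<in>A. f i x)"
  using assms
  by (induction A rule: infinite_finite_induct) (auto intro: Ck_zero Ck_add)

lemma Ck_laplacian:
  assumes "Ck (k + 2) f"
  shows "Ck k (laplacian f)"
  unfolding laplacian_def using assms by (intro Ck_sum) auto

lemma Ck_6_laplacian:
  assumes "Ck 6 f"
  shows "Ck 4 (laplacian f)" "Ck 2 (laplacian (laplacian f))"
    "Ck 0 (laplacian (laplacian (laplacian f)))"
proof -
  show 4: "Ck 4 (laplacian f)"
    by (rule Ck_laplacian) (use assms in simp)
  show 2: "Ck 2 (laplacian (laplacian f))"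
    by (rule Ck_laplacian) (use 4 in simp)
  show "Ck 0 (laplacian (laplacian (laplacian f)))"
    by (rule Ck_laplacian) (use 2 in \<open>simp del: Ck.simps add: numeral_2_eq_2\<close>)
qed

section \<open>Affine changes of variable and supports\<close>

text \<open>The outer factor \<open>d\<close> makes this shape closed under differentiation: it
  becomes \<open>d * c\<close>, so inductions and repeated Laplacians can reuse the same
  rule.\<close>

lemma DERIV_affine_line:
  assumes "Ck (Suc k) f"
  shows "((\<lambda>t. d * f (c *\<^sub>R (x + t *\<^sub>R axis i 1) + a)) has_real_derivative
    (d * c) * partial i f (c *\<^sub>R x + a)) (at 0)"
proof -
  have "((\<lambda>t. f ((c *\<^sub>R x + a) + (c * t) *\<^sub>R axis i 1)) has_real_derivative
      partial i f (c *\<^sub>R x + a) * c) (at 0)"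
    by (rule DERIV_chain2[where g = "\<lambda>t. c * t" and f = "\<lambda>s. f ((c *\<^sub>R x + a) + s *\<^sub>R axis i 1)"])
      (auto intro!: Ck_DERIV[OF assms] derivative_eq_intros)
  then have "((\<lambda>t. d * f ((c *\<^sub>R x + a) + (c * t) *\<^sub>R axis i 1)) has_real_derivative
      d * (partial i f (c *\<^sub>R x + a) * c)) (at 0)"
    by (rule DERIV_cmult)
  then show ?thesis by (simp add: algebra_simps)
qed

lemma Ck_affine:
  assumes "Ck k f"
  shows "Ck k (\<lambda>x. d * f (c *\<^sub>R x + a))"
  using assms
proof (induction k arbitrary: f d)
  case 0
  then have "continuous_on UNIV f" by simp
  then show ?case
    by (auto intro!: continuous_intros continuous_on_compose2[of UNIV f])
next
  case (Suc k)
  show ?case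
  proof (rule Ck_SucI)
    show "continuous_on UNIV (\<lambda>x. d * f (c *\<^sub>R x + a))"
      using Ck_imp_continuous[OF Suc.prems]
      by (auto intro!: continuous_intros continuous_on_compose2[of UNIV f])
    show "((\<lambda>t. d * f (c *\<^sub>R (x + t *\<^sub>R axis i 1) + a)) has_real_derivative
        (d * c) * partial i f (c *\<^sub>R x + a)) (at 0)" for i x
      by (rule DERIV_affine_line[OF Suc.prems])
    show "Ck k (\<lambda>x. (d * c) * partial i f (c *\<^sub>R x + a))" for i
      using Suc.prems by (intro Suc.IH) auto
  qed
qed

lemma laplacian_affine:
  assumes "Ck (k + 2) f"
  shows "laplacian (\<lambda>x. d * f (c *\<^sub>R x + a)) = (\<lambda>x. (d * c\<^sup>2) * laplacian f (c *\<^sub>R x + a))"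
proof -
  have "partial i (\<lambda>x. d * f (c *\<^sub>R x + a)) = (\<lambda>x. (d * c) * partial i f (c *\<^sub>R x + a))" for i
    using assms by (intro ext partialI(2) DERIV_affine_line[of "Suc k"]) auto
  moreover have "partial i (\<lambda>x. (d * c) * partial i f (c *\<^sub>R x + a)) =
      (\<lambda>x. (d * c * c) * partial i (partial i f) (c *\<^sub>R x + a))" for i
    using assms by (intro ext partialI(2) DERIV_affine_line[of k]) auto
  ultimately show ?thesis
    by (auto simp: laplacian_def sum_distrib_left power2_eq_square mult.assoc)
qed

text \<open>The complement of \<open>S\<close> is open, so \<open>f\<close> vanishes on a short
  segment around \<open>x\<close> in every axis direction.\<close>

lemma partial_eq_0_outside:
  fixes f :: "real^'n::finite \<Rightarrow> real"
  assumes "closed S" "\<And>x. x \<notin> S \<Longrightarrow> f x = 0" "x \<notin> S"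
  shows "partial i f x = 0"
proof (rule partialI(2))
  have "open ((\<lambda>t. x + t *\<^sub>R axis i 1 :: real^'n) -` (- S))"
    using assms(1) by (intro open_vimage continuous_intros) auto
  moreover have "0 \<in> (\<lambda>t. x + t *\<^sub>R axis i 1 :: real^'n) -` (- S)"
    using assms(3) by simp
  ultimately have "eventually (\<lambda>t. t \<in> (\<lambda>t. x + t *\<^sub>R axis i 1 :: real^'n) -` (- S)) (nhds (0::real))"
    by (rule eventually_nhds_in_open)
  then have "eventually (\<lambda>t. 0 = f (x + t *\<^sub>R axis i 1)) (nhds (0::real))"
    by eventually_elim (use assms(2) in auto)
  then show "((\<lambda>t. f (x + t *\<^sub>R axis i 1)) has_real_derivative 0) (at 0)"
    using DERIV_cong_ev[of 0 0 "\<lambda>t. 0" "\<lambda>t. f (x + t *\<^sub>R axis i 1)" 0 0] by simp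
qed

lemma laplacian_eq_0_outside:
  fixes f :: "real^'n::finite \<Rightarrow> real"
  assumes "closed S" "\<And>x. x \<notin> S \<Longrightarrow> f x = 0" "x \<notin> S"
  shows "laplacian f x = 0"
  unfolding laplacian_def
  by (intro sum.neutral ballI partial_eq_0_outside[OF assms(1) _ assms(3)]
      partial_eq_0_outside[OF assms(1)] assms(2))

section \<open>Smooth functions of one variable and their products over coordinates\<close>

text \<open>The class of \<open>k\<close> times continuously differentiable functions on the line.
  Quantifying the derivative existentially lets closed formulas serve directly as witnesses.\<close>

fun smooth_line :: "nat \<Rightarrow> (real \<Rightarrow> real) \<Rightarrow> bool" where
  "smooth_line 0 f = continuous_on UNIV f"
| "smooth_line (Suc k) f = (\<exists>f'. (\<forall>t. (f has_real_derivative f' t) (at t)) \<and> smooth_line k f')"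

lemma smooth_line_imp_continuous: "smooth_line k f \<Longrightarrow> continuous_on UNIV f"
  by (cases k) (auto intro!: continuous_at_imp_continuous_on dest: DERIV_isCont)

lemma smooth_line_Suc_imp: "smooth_line (Suc k) f \<Longrightarrow> smooth_line k f"
proof (induction k arbitrary: f)
  case 0
  then show ?case using smooth_line_imp_continuous[OF 0] by simp
next
  case (Suc k)
  then obtain f' where "\<forall>t. (f has_real_derivative f' t) (at t)" "smooth_line (Suc k) f'"
    using smooth_line.simps(2) by blast
  then show ?case using Suc.IH[of f'] by auto
qed

lemma smooth_line_add:
  "smooth_line k f \<Longrightarrow> smooth_line k g \<Longrightarrow> smooth_line k (\<lambda>t. f t + g t)"
proof (induction k arbitrary: f g)
  case (Suc k)
  then obtain f' g' where "\<forall>t. (f has_real_derivative f' t) (at t)" "smooth_line k f'"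
    "\<forall>t. (g has_real_derivative g' t) (at t)" "smooth_line k g'" by auto
  then show ?case
    using Suc.IH[of f' g'] by (auto intro!: exI[of _ "\<lambda>t. f' t + g' t"] DERIV_add)
qed (auto intro: continuous_intros)

lemma smooth_line_mult:
  "smooth_line k f \<Longrightarrow> smooth_line k g \<Longrightarrow> smooth_line k (\<lambda>t. f t * g t)"
proof (induction k arbitrary: f g)
  case (Suc k)
  then obtain f' g' where d: "\<forall>t. (f has_real_derivative f' t) (at t)" "smooth_line k f'"
    "\<forall>t. (g has_real_derivative g' t) (at t)" "smooth_line k g'" by auto
  have "smooth_line k (\<lambda>t. f' t * g t + g' t * f t)"
    using d Suc.prems by (intro smooth_line_add Suc.IH) (auto intro: smooth_line_Suc_imp simp del: smooth_line.simps)
  then show ?case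
    using d by (auto intro!: exI[of _ "\<lambda>t. f' t * g t + g' t * f t"] DERIV_mult)
qed (auto intro: continuous_intros)

text \<open>Away from 0 the function is locally a power or 0. At 0 the difference quotient is
  \<open>max 0 h ^ Suc m\<close>, which tends to 0 because its exponent is positive.\<close>

lemma DERIV_max_0_power:
  fixes t :: real
  shows "((\<lambda>t. max 0 t ^ Suc (Suc m)) has_real_derivative real (Suc (Suc m)) * max 0 t ^ Suc m) (at t)"
proof -
  consider "t > 0" | "t < 0" | "t = 0" by linarith
  then show ?thesis
  proof cases
    case 1
    have "((\<lambda>t. t ^ Suc (Suc m)) has_real_derivative real (Suc (Suc m)) * t ^ Suc m) (at t)"
      using DERIV_pow[of "Suc (Suc m)" t] by simp
    moreover have "eventually (\<lambda>s. s ^ Suc (Suc m) = max 0 s ^ Suc (Suc m)) (nhds t)"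
      using eventually_nhds_in_open[of "{0<..}" t] 1 by (auto elim!: eventually_mono)
    ultimately show ?thesis
      using 1 DERIV_cong_ev[of t t "\<lambda>t. t ^ Suc (Suc m)" "\<lambda>t. max 0 t ^ Suc (Suc m)"
        "real (Suc (Suc m)) * t ^ Suc m" "real (Suc (Suc m)) * t ^ Suc m"] by (simp add: max_def)
  next
    case 2
    have "eventually (\<lambda>s. 0 = max 0 s ^ Suc (Suc m)) (nhds t)"
      using eventually_nhds_in_open[of "{..<0}" t] 2 by (auto elim!: eventually_mono)
    then show ?thesis
      using 2 DERIV_cong_ev[of t t "\<lambda>t. 0" "\<lambda>t. max 0 t ^ Suc (Suc m)" 0 0] by (simp add: max_def)
  next
    case 3
    have "((\<lambda>h. max 0 h ^ Suc m) \<longlongrightarrow> max 0 (0::real) ^ Suc m) (at 0)"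
      by (intro tendsto_intros)
    moreover have "eventually (\<lambda>h. max 0 h ^ Suc m = (max 0 (0 + h) ^ Suc (Suc m) - max 0 0 ^ Suc (Suc m)) / h) (at (0::real))"
      by (auto simp: eventually_at_filter max_def)
    ultimately have "((\<lambda>h. (max 0 (0 + h) ^ Suc (Suc m) - max 0 0 ^ Suc (Suc m)) / h) \<longlongrightarrow> max 0 (0::real) ^ Suc m) (at 0)"
      by (rule Lim_transform_eventually)
    then show ?thesis using 3 by (simp add: DERIV_def)
  qed
qed

text \<open>Each derivative lowers the exponent by one, so after \<open>k\<close> of them a
  continuous first power remains. The factor \<open>c\<close> absorbs the constants that
  arise.\<close>

lemma smooth_line_max_0_power:
  "smooth_line k (\<lambda>t. c * max 0 (a + b * t) ^ Suc k)"
proof (induction k arbitrary: c)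
  case 0
  show ?case by (auto intro!: continuous_intros)
next
  case (Suc k)
  have "((\<lambda>t. c * max 0 (a + b * t) ^ Suc (Suc k)) has_real_derivative
      (c * real (Suc (Suc k)) * b) * max 0 (a + b * t) ^ Suc k) (at t)" for t
  proof -
    have "((\<lambda>t. max 0 (a + b * t) ^ Suc (Suc k)) has_real_derivative
      (real (Suc (Suc k)) * max 0 (a + b * t) ^ Suc k) * b) (at t)"
      by (rule DERIV_chain2[OF DERIV_max_0_power]) (auto intro!: derivative_eq_intros)
    from DERIV_cmult[OF this, of c] show ?thesis by (simp add: mult_ac)
  qed
  then show ?case
    unfolding smooth_line.simps
    by (intro exI[of _ "\<lambda>t. (c * real (Suc (Suc k)) * b) * max 0 (a + b * t) ^ Suc k"] conjI allI Suc.IH)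
qed

lemma continuous_on_prod_coords:
  fixes f :: "'n::finite \<Rightarrow> real \<Rightarrow> real"
  assumes "\<And>j. continuous_on UNIV (f j)"
  shows "continuous_on UNIV (\<lambda>x :: real^'n. \<Prod>j\<in>UNIV. f j (x $ j))"
proof (rule continuous_on_prod)
  fix j
  show "continuous_on UNIV (\<lambda>x :: real^'n. f j (x $ j))"
    by (rule continuous_on_compose2[OF assms]) (auto intro!: continuous_intros)
qed

text \<open>Differentiating in direction \<open>i\<close> changes the \<open>i\<close>-th factor
  only. The result is again a product over coordinates, for the family \<open>f(i := f' i)\<close>,
  which makes the induction close.\<close>

lemma Ck_prod_coords:
  fixes f :: "'n::finite \<Rightarrow> real \<Rightarrow> real"
  assumes "\<And>j. smooth_line k (f j)"
  shows "Ck k (\<lambda>x :: real^'n. \<Prod>j\<in>UNIV. f j (x $ j))"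
  using assms
proof (induction k arbitrary: f)
  case 0
  then show ?case
    using continuous_on_prod_coords[of f] by simp
next
  case (Suc k)
  then have "\<forall>j. \<exists>f'. (\<forall>t. (f j has_real_derivative f' t) (at t)) \<and> smooth_line k f'"
    by simp
  then obtain f' where f': "\<And>j t. (f j has_real_derivative f' j t) (at t)" "\<And>j. smooth_line k (f' j)"
    by metis
  show ?case
  proof (rule Ck_SucI)
    show "continuous_on UNIV (\<lambda>x :: real^'n. \<Prod>j\<in>UNIV. f j (x $ j))"
      by (intro continuous_on_prod_coords smooth_line_imp_continuous[OF Suc.prems])
    show "Ck k (\<lambda>x. \<Prod>j\<in>UNIV. (f(i := f' i)) j (x $ j))" for i
      using f' Suc.prems by (intro Suc.IH) (auto intro: smooth_line_Suc_imp simp del: smooth_line.simps)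
    fix i and x :: "real^'n"
    have split: "(\<Prod>j\<in>UNIV. g j) = g i * (\<Prod>j\<in>UNIV - {i}. g j)" for g :: "'n \<Rightarrow> real"
      by (rule prod.remove) auto
    have "((\<lambda>t. f i (x $ i + t)) has_real_derivative f' i (x $ i)) (at 0)"
      using f'(1)[of i "x $ i"] DERIV_shift[of "f i" _ 0 "x $ i"] by (simp add: add.commute)
    then have "((\<lambda>t. f i (x $ i + t) * (\<Prod>j\<in>UNIV - {i}. f j (x $ j))) has_real_derivative
       f' i (x $ i) * (\<Prod>j\<in>UNIV - {i}. f j (x $ j))) (at 0)"
      by (rule DERIV_cmult_right)
    moreover have "(\<Prod>j\<in>UNIV. f j ((x + t *\<^sub>R axis i 1) $ j)) =
        f i (x $ i + t) * (\<Prod>j\<in>UNIV - {i}. f j (x $ j))" for t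
      unfolding split by (auto simp: axis_def intro!: prod.cong)
    moreover have "(\<Prod>j\<in>UNIV. (f(i := f' i)) j (x $ j)) =
        f' i (x $ i) * (\<Prod>j\<in>UNIV - {i}. f j (x $ j))"
      unfolding split by (auto intro!: prod.cong)
    ultimately show "((\<lambda>t. \<Prod>j\<in>UNIV. f j ((x + t *\<^sub>R axis i 1) $ j)) has_real_derivative
        (\<Prod>j\<in>UNIV. (f(i := f' i)) j (x $ j))) (at 0)"
      by simp
  qed
qed

section \<open>Integration by parts against compactly supported functions\<close>

lemma lborel_integral_shift:
  fixes f :: "'a::euclidean_space \<Rightarrow> real"
  assumes "f \<in> borel_measurable borel"
  shows "(\<integral>x. f (x + a) \<partial>lborel) = (\<integral>x. f x \<partial>lborel)"
proof -
  have "(\<integral>x. f x \<partial>lborel) = (\<integral>x. f x \<partial>(distr lborel borel ((+) a)))"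
    by (simp add: lborel_distr_plus)
  also have "\<dots> = (\<integral>x. f (a + x) \<partial>lborel)"
    using assms by (intro integral_distr) auto
  finally show ?thesis by (simp add: add.commute)
qed

lemma integrable_compact_support:
  fixes f :: "'a::euclidean_space \<Rightarrow> real"
  assumes "compact S" "continuous_on UNIV f" "\<And>x. x \<notin> S \<Longrightarrow> f x = 0"
  shows "integrable lborel f"
proof -
  have "integrable lborel (\<lambda>x. indicator S x *\<^sub>R f x)"
    using assms by (intro borel_integrable_compact) (auto intro: continuous_on_subset)
  moreover have "(\<lambda>x. indicator S x *\<^sub>R f x) = f"
    using assms(3) by (force simp: indicator_def)
  ultimately show ?thesis by simp
qed

text \<open>Difference quotients have integral zero by translation invariance of Lebesgue measure;
  pass to the limit by dominated convergence.\<close>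
lemma integral_line_derivative_eq_0:
  fixes F F' :: "'a::euclidean_space \<Rightarrow> real"
  assumes S: "compact S"
    and F: "continuous_on UNIV F" "\<And>x. x \<notin> S \<Longrightarrow> F x = 0"
    and F': "continuous_on UNIV F'" "\<And>x. x \<notin> S \<Longrightarrow> F' x = 0"
    and deriv: "\<And>x. ((\<lambda>t. F (x + t *\<^sub>R e)) has_real_derivative F' x) (at 0)"
  shows "(\<integral>x. F' x \<partial>lborel) = 0"
proof -
  have [measurable]: "F \<in> borel_measurable borel" "F' \<in> borel_measurable borel"
    using F(1) F'(1) by (auto intro: borel_measurable_continuous_onI)
  have "bounded (F' ` S)"
    using S F'(1) by (intro compact_imp_bounded compact_continuous_image) (auto intro: continuous_on_subset)
  then obtain M0 where M0: "\<And>x. x \<in> S \<Longrightarrow> \<bar>F' x\<bar> \<le> M0"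
    by (auto simp: bounded_iff)
  define M where "M = max 0 M0"
  have M: "\<bar>F' x\<bar> \<le> M" for x
    using M0[of x] F'(2)[of x] by (cases "x \<in> S") (auto simp: M_def)
  obtain B where B: "\<And>x. x \<in> S \<Longrightarrow> norm x \<le> B"
    using compact_imp_bounded[OF S] by (auto simp: bounded_iff)
  \<comment> \<open>Dominated convergence is applied along a sequence of steps in (0, 1] tending to
    0.\<close>
  define h where "h k = 1 / real (Suc k)" for k
  define s where "s k x = (F (x + h k *\<^sub>R e) - F x) / h k" for k x
  \<comment> \<open>As \<open>h k \<le> 1\<close>, the shift moves the support by at most
    \<open>norm e\<close>; outside this enlarged ball both terms of the quotient vanish.\<close>
  define w where "w x = M * indicator (cball (0::'a) (B + norm e)) x" for x
  have h: "0 < h k" "h k \<le> 1" for k by (auto simp: h_def)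
  have iF: "integrable lborel F"
    using integrable_compact_support[OF S F] .
  have "(\<lambda>k. integral\<^sup>L lborel (s k)) \<longlonglongrightarrow> integral\<^sup>L lborel F'"
  proof (rule integral_dominated_convergence[where w = w])
    show "F' \<in> borel_measurable lborel" "s k \<in> borel_measurable lborel" for k
      by (simp_all add: s_def[abs_def])
    show "integrable lborel w"
      unfolding w_def by (intro integrable_mult_right integrable_real_indicator)
        (use emeasure_bounded_finite[OF bounded_cball] in auto)
    have "h \<longlonglongrightarrow> 0"
      unfolding h_def using LIMSEQ_inverse_real_of_nat by (simp add: inverse_eq_divide)
    then have hlim: "filterlim h (at 0) sequentially"
      using h by (auto simp: filterlim_at intro!: always_eventually) (metis less_irrefl)
    have "(\<lambda>k. s k x) \<longlonglongrightarrow> F' x" for x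
    proof -
      have "((\<lambda>t. (F (x + t *\<^sub>R e) - F x) / t) \<longlongrightarrow> F' x) (at 0)"
        using deriv[of x] by (simp add: DERIV_def)
      from filterlim_compose[OF this hlim] show ?thesis by (simp add: s_def)
    qed
    then show "AE x in lborel. (\<lambda>k. s k x) \<longlonglongrightarrow> F' x" by simp
    have "norm (s k x) \<le> w x" for k x
    proof (cases "norm x \<le> B + norm e")
      case True
      \<comment> \<open>The mean value theorem turns the quotient into a value of \<open>F'\<close>,
        which is bounded by \<open>M\<close> uniformly in \<open>k\<close>.\<close>
      obtain z where z: "F (x + h k *\<^sub>R e) - F (x + 0 *\<^sub>R e) = (h k - 0) * F' (x + z *\<^sub>R e)"
        using MVT2[of 0 "h k" "\<lambda>t. F (x + t *\<^sub>R e)" "\<lambda>t. F' (x + t *\<^sub>R e)"] h(1)[of k]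
          DERIV_line[OF deriv] by blast
      then have "s k x = F' (x + z *\<^sub>R e)"
        using h(1)[of k] by (simp add: s_def)
      then show ?thesis using M[of "x + z *\<^sub>R e"] True by (simp add: w_def)
    next
      case False
      have "x \<notin> S" using False B[of x] norm_ge_zero[of e] by linarith
      moreover have "x + h k *\<^sub>R e \<notin> S"
      proof
        assume "x + h k *\<^sub>R e \<in> S"
        then have "norm (x + h k *\<^sub>R e) \<le> B" by (rule B)
        moreover have "norm x \<le> norm (x + h k *\<^sub>R e) + norm (h k *\<^sub>R e)"
          using norm_triangle_ineq4[of "x + h k *\<^sub>R e" "h k *\<^sub>R e"] by simp
        moreover have "norm (h k *\<^sub>R e) \<le> norm e"
          using h[of k] by (simp add: mult_left_le_one_le)
        ultimately show False using False by linarith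
      qed
      ultimately show ?thesis using F(2) by (simp add: s_def w_def M_def)
    qed
    then show "AE x in lborel. norm (s k x) \<le> w x" for k by simp
  qed
  moreover have "integral\<^sup>L lborel (s k) = 0" for k
  proof -
    have eq: "(\<integral>x. F (x + h k *\<^sub>R e) \<partial>lborel) = (\<integral>x. F x \<partial>lborel)"
      by (rule lborel_integral_shift) simp
    have "integrable lborel (\<lambda>x. F (x + h k *\<^sub>R e))"
    proof (rule integrable_compact_support)
      show "compact ((\<lambda>x. x - h k *\<^sub>R e) ` S)"
        using S by (intro compact_continuous_image continuous_intros)
      show "continuous_on UNIV (\<lambda>x. F (x + h k *\<^sub>R e))"
        by (rule continuous_on_compose2[OF F(1)]) (auto intro!: continuous_intros)
      show "F (x + h k *\<^sub>R e) = 0" if "x \<notin> (\<lambda>x. x - h k *\<^sub>R e) ` S" for x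
        using that by (intro F(2)) (auto simp: image_iff algebra_simps)
    qed
    then show ?thesis
      using iF eq by (simp add: s_def[abs_def])
  qed
  ultimately show ?thesis
    using LIMSEQ_unique[of "\<lambda>k. integral\<^sup>L lborel (s k)" 0] by simp
qed

text \<open>The product \<open>f * \<phi>\<close> has compact support, so the integral of its
  partial derivative vanishes; the product rule splits that integral in two.\<close>

lemma integral_partial_by_parts:
  fixes f \<phi> :: "real^'n::finite \<Rightarrow> real"
  assumes f: "Ck (Suc k) f" and \<phi>: "Ck (Suc l) \<phi>"
    and S: "compact S" "\<And>x. x \<notin> S \<Longrightarrow> \<phi> x = 0"
  shows "integrable lborel (\<lambda>x. partial i f x * \<phi> x)"
    and "integrable lborel (\<lambda>x. f x * partial i \<phi> x)"
    and "(\<integral>x. partial i f x * \<phi> x \<partial>lborel) = - (\<integral>x. f x * partial i \<phi> x \<partial>lborel)"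
proof -
  have cont: "continuous_on UNIV f" "continuous_on UNIV \<phi>"
    using f \<phi> by (auto dest: Ck_imp_continuous)
  have cont': "continuous_on UNIV (partial i f)" "continuous_on UNIV (partial i \<phi>)"
    using f \<phi> by (auto intro: Ck_imp_continuous)
  have z: "partial i \<phi> x = 0" if "x \<notin> S" for x
    using partial_eq_0_outside[OF compact_imp_closed[OF S(1)] S(2) that] .
  show i1: "integrable lborel (\<lambda>x. partial i f x * \<phi> x)"
    by (rule integrable_compact_support[OF S(1)]) (auto intro!: continuous_intros cont cont' simp: S(2))
  show i2: "integrable lborel (\<lambda>x. f x * partial i \<phi> x)"
    by (rule integrable_compact_support[OF S(1)]) (auto intro!: continuous_intros cont cont' simp: z)
  have "(\<integral>x. partial i f x * \<phi> x + f x * partial i \<phi> x \<partial>lborel) = 0"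
  proof (rule integral_line_derivative_eq_0[OF S(1), where F = "\<lambda>x. f x * \<phi> x" and e = "axis i 1"])
    show "((\<lambda>t. f (x + t *\<^sub>R axis i 1) * \<phi> (x + t *\<^sub>R axis i 1)) has_real_derivative
        partial i f x * \<phi> x + f x * partial i \<phi> x) (at 0)" for x
      using DERIV_mult[OF Ck_DERIV[OF f, of x i] Ck_DERIV[OF \<phi>, of x i]] by (simp add: mult.commute)
  qed (auto intro!: continuous_intros cont cont' simp: S(2) z)
  then show "(\<integral>x. partial i f x * \<phi> x \<partial>lborel) = - (\<integral>x. f x * partial i \<phi> x \<partial>lborel)"
    using i1 i2 by simp
qed

text \<open>Two integrations by parts in each coordinate, whose signs cancel. The second one uses
  that \<open>partial i \<phi>\<close> also vanishes outside \<open>S\<close>.\<close>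

lemma integral_laplacian_by_parts:
  fixes f \<phi> :: "real^'n::finite \<Rightarrow> real"
  assumes f: "Ck (k + 2) f" and \<phi>: "Ck (l + 2) \<phi>"
    and S: "compact S" "\<And>x. x \<notin> S \<Longrightarrow> \<phi> x = 0"
  shows "(\<integral>x. laplacian f x * \<phi> x \<partial>lborel) = (\<integral>x. f x * laplacian \<phi> x \<partial>lborel)"
proof -
  have f': "Ck (Suc k) (partial i f)" and \<phi>': "Ck (Suc l) (partial i \<phi>)" for i
    using f \<phi> by auto
  have f1: "Ck (Suc k) f" and \<phi>1: "Ck (Suc l) \<phi>"
    using f \<phi> by (auto elim!: Ck_mono simp del: Ck.simps)
  have z: "partial i \<phi> x = 0" if "x \<notin> S" for x i
    using partial_eq_0_outside[OF compact_imp_closed[OF S(1)] S(2) that] .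
  note p1 = integral_partial_by_parts[OF f' \<phi>1 S]
  note p2 = integral_partial_by_parts[OF f1 \<phi>' S(1) z]
  have "(\<integral>x. laplacian f x * \<phi> x \<partial>lborel) = (\<Sum>i\<in>UNIV. \<integral>x. partial i (partial i f) x * \<phi> x \<partial>lborel)"
    unfolding laplacian_def sum_distrib_right by (rule Bochner_Integration.integral_sum) (rule p1)
  also have "\<dots> = (\<Sum>i\<in>UNIV. \<integral>x. f x * partial i (partial i \<phi>) x \<partial>lborel)"
    by (intro sum.cong refl) (simp add: p1(3) p2(3))
  also have "\<dots> = (\<integral>x. f x * laplacian \<phi> x \<partial>lborel)"
    unfolding laplacian_def sum_distrib_left
    by (rule Bochner_Integration.integral_sum[symmetric]) (rule p2)
  finally show ?thesis .
qed

section \<open>The bump function and the estimate on annuli\<close>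

lemma exists_bump_function:
  obtains \<phi> :: "real^'n::finite \<Rightarrow> real"
  where "Ck k \<phi>" "\<And>x. \<phi> x \<ge> 0" "\<And>x. x \<notin> cbox (-1) 1 \<Longrightarrow> \<phi> x = 0" "(\<integral>x. \<phi> x \<partial>lborel) > 0"
proof -
  \<comment> \<open>This is \<open>(1 - t^2) ^ Suc k\<close> on [-1, 1] and 0 elsewhere; the factors
    1 match the form of \<open>smooth_line_max_0_power\<close>.\<close>
  define \<eta> where "\<eta> = (\<lambda>t::real. (1 * max 0 (1 + 1 * t) ^ Suc k) * (1 * max 0 (1 + (-1) * t) ^ Suc k))"
  define \<phi> where "\<phi> = (\<lambda>x::real^'n. \<Prod>j\<in>UNIV. \<eta> (x $ j))"
  have C: "Ck k \<phi>"
    unfolding \<phi>_def \<eta>_def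
    by (intro Ck_prod_coords smooth_line_mult smooth_line_max_0_power)
  have nonneg: "\<phi> x \<ge> 0" for x
    unfolding \<phi>_def \<eta>_def by (intro prod_nonneg) auto
  have zero: "\<phi> x = 0" if "x \<notin> cbox (-1) 1" for x
  proof -
    obtain j where "x $ j < -1 \<or> x $ j > 1"
      using \<open>x \<notin> cbox (-1) 1\<close> by (auto simp: mem_box_cart not_le)
    then have "\<eta> (x $ j) = 0" by (auto simp: \<eta>_def)
    then show ?thesis unfolding \<phi>_def by (auto intro!: prod_zero)
  qed
  have int: "integrable lborel \<phi>"
    by (rule integrable_compact_support[OF compact_cbox Ck_imp_continuous[OF C] zero])
  \<comment> \<open>A zero integral would make the set where \<open>\<phi>\<close> is nonzero an
    open null set, yet it contains the origin.\<close>
  have "(\<integral>x. \<phi> x \<partial>lborel) \<noteq> 0"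
  proof
    assume "(\<integral>x. \<phi> x \<partial>lborel) = 0"
    then have "AE x in lborel. \<phi> x = 0"
      using integral_nonneg_eq_0_iff_AE[OF int] nonneg by simp
    moreover have op: "open {x. \<phi> x \<noteq> 0}"
      using Ck_imp_continuous[OF C] by (intro open_Collect_neq continuous_intros)
    ultimately have "{x. \<phi> x \<noteq> 0} \<in> null_sets lborel"
      using AE_iff_null[of lborel "\<lambda>x. \<phi> x = 0"] by auto
    then have "negligible {x. \<phi> x \<noteq> 0}"
      by (simp add: negligible_iff_null_sets null_sets_completionI)
    moreover have "\<phi> 0 \<noteq> 0" by (simp add: \<phi>_def \<eta>_def)
    ultimately show False using open_not_negligible[OF op] by blast
  qed
  moreover have "(\<integral>x. \<phi> x \<partial>lborel) \<ge> 0"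
    using nonneg by simp
  ultimately have "(\<integral>x. \<phi> x \<partial>lborel) > 0" by linarith
  with C nonneg zero show ?thesis by (rule that)
qed

text \<open>One \<open>\<epsilon>\<close> serves all \<open>u\<close> and \<open>R\<close> because
  the solution is rescaled while the bump function stays fixed: \<open>I\<close> and
  \<open>K\<close> depend on the bump function alone.\<close>

lemma annulus_lower_bound:
  fixes q :: real
  assumes q: "q > 0"
  obtains \<epsilon> :: real where "\<epsilon> > 0"
    "\<And>(u :: real^'n::finite \<Rightarrow> real) R. Ck 6 u \<Longrightarrow> (\<And>x. u x > 0) \<Longrightarrow>
      (\<And>x. laplacian (laplacian (laplacian u)) x = u x powr (- q)) \<Longrightarrow> R > 0 \<Longrightarrow>
      \<exists>x. R / 2 \<le> norm x \<and> norm x \<le> R \<and> u x > \<epsilon> * R powr (6 / (q + 1))"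
proof -
  let ?Q = "cbox (-1) 1 :: (real^'n) set"
  let ?L = "laplacian :: (real^'n \<Rightarrow> real) \<Rightarrow> _"
  obtain \<phi> :: "real^'n \<Rightarrow> real" where \<phi>: "Ck 6 \<phi>" "\<And>x. \<phi> x \<ge> 0"
    "\<And>x. x \<notin> ?Q \<Longrightarrow> \<phi> x = 0" "(\<integral>x. \<phi> x \<partial>lborel) > 0"
    using exists_bump_function[of 6] by blast
  note C\<phi> = Ck_6_laplacian[OF \<phi>(1)]
  have z1: "?L \<phi> x = 0" if "x \<notin> ?Q" for x
    using laplacian_eq_0_outside[OF closed_cbox \<phi>(3) that] .
  have z2: "?L (?L \<phi>) x = 0" if "x \<notin> ?Q" for x
    using laplacian_eq_0_outside[OF closed_cbox z1 that] .
  have z3: "?L (?L (?L \<phi>)) x = 0" if "x \<notin> ?Q" for x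
    using laplacian_eq_0_outside[OF closed_cbox z2 that] .
  define I where "I = (\<integral>x. \<phi> x \<partial>lborel)"
  define K where "K = (\<integral>x. \<bar>?L (?L (?L \<phi>)) x\<bar> \<partial>lborel)"
  \<comment> \<open>Points of the cube have norm at most \<open>CARD('n)\<close>, so scaling by
    \<open>R * \<delta>\<close> puts the cube into a ball of radius \<open>R / 4\<close>.\<close>
  define \<delta> where "\<delta> = 1 / (4 * real CARD('n))"
  \<comment> \<open>Chosen so that
    \<open>\<epsilon> powr (q + 1) * (K + 1) = \<delta> ^ 6 * I\<close>. The added 1 prevents
    division by zero and makes the later inequality strict.\<close>
  define \<epsilon> where "\<epsilon> = (\<delta> ^ 6 * I / (K + 1)) powr (1 / (q + 1))"
  have I: "I > 0" using \<phi>(4) by (simp add: I_def)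
  have K: "K \<ge> 0" by (simp add: K_def)
  have \<delta>: "\<delta> > 0" by (simp add: \<delta>_def)
  have \<epsilon>: "\<epsilon> > 0" using I K \<delta> by (simp add: \<epsilon>_def)
  have "\<epsilon> powr (q + 1) = \<delta> ^ 6 * I / (K + 1)"
    using q I K \<delta> by (simp add: \<epsilon>_def powr_powr)
  then have "\<epsilon> powr (q + 1) * K + \<epsilon> powr (q + 1) = \<delta> ^ 6 * I"
    using K by (simp add: field_simps)
  moreover have "\<epsilon> powr (q + 1) > 0" using \<epsilon> by simp
  ultimately have \<epsilon>K: "\<epsilon> powr (q + 1) * K < \<delta> ^ 6 * I" by linarith
  have "\<exists>x. R / 2 \<le> norm x \<and> norm x \<le> R \<and> u x > \<epsilon> * R powr (6 / (q + 1))"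
    if u: "Ck 6 u" "\<And>x. u x > 0" "\<And>x. ?L (?L (?L u)) x = u x powr (- q)" and R: "R > 0"
    for u :: "real^'n \<Rightarrow> real" and R
  proof (rule ccontr)
    define m where "m = \<epsilon> * R powr (6 / (q + 1))"
    assume "\<not> ?thesis"
    then have le: "u x \<le> m" if "R / 2 \<le> norm x" "norm x \<le> R" for x
      using that by (auto simp: m_def not_less)
    have m: "m > 0" using \<epsilon> R by (simp add: m_def)
    note Cu = Ck_6_laplacian[OF u(1)]
    define c where "c = R * \<delta>"
    \<comment> \<open>A centre halfway between the two radii of the annulus, on an arbitrary axis;
      it leaves a margin of \<open>R / 4\<close> on both sides.\<close>
    define a :: "real^'n" where "a = (3/4 * R) *\<^sub>R axis undefined 1"
    \<comment> \<open>The factor 1 gives the form required by \<open>laplacian_affine\<close>; three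
      Laplacians then produce the factor \<open>c ^ 6\<close>.\<close>
    define g where "g = (\<lambda>x. 1 * u (c *\<^sub>R x + a))"
    have c: "c > 0" using R \<delta> by (simp add: c_def)
    have Cg: "Ck 6 g" unfolding g_def by (rule Ck_affine[OF u(1)])
    have Lg: "?L g = (\<lambda>x. (1 * c\<^sup>2) * ?L u (c *\<^sub>R x + a))"
      unfolding g_def using u(1) by (intro laplacian_affine[of 4]) (simp del: Ck.simps)
    have LLg: "?L (?L g) = (\<lambda>x. (1 * c\<^sup>2 * c\<^sup>2) * ?L (?L u) (c *\<^sub>R x + a))"
      unfolding Lg using Cu(1) by (intro laplacian_affine[of 2]) (simp del: Ck.simps)
    have LLLg: "?L (?L (?L g)) = (\<lambda>x. (1 * c\<^sup>2 * c\<^sup>2 * c\<^sup>2) * ?L (?L (?L u)) (c *\<^sub>R x + a))"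
      unfolding LLg using Cu(2) by (intro laplacian_affine[of 0]) (simp del: Ck.simps add: numeral_2_eq_2)
    note CLg = Ck_6_laplacian[OF Cg]
    have ann: "R / 2 \<le> norm (c *\<^sub>R x + a)" "norm (c *\<^sub>R x + a) \<le> R" if "x \<in> ?Q" for x
    proof -
      have "norm x \<le> (\<Sum>i\<in>UNIV. \<bar>x $ i\<bar>)" by (rule norm_le_l1_cart)
      also have "\<dots> \<le> (\<Sum>i\<in>(UNIV::'n set). 1)"
        using that by (intro sum_mono) (auto simp: mem_box_cart abs_le_iff minus_le_iff)
      finally have "norm x \<le> real CARD('n)" by simp
      then have "c * norm x \<le> c * real CARD('n)" using c by simp
      also have "\<dots> = R / 4" by (simp add: c_def \<delta>_def)
      finally have "norm (c *\<^sub>R x) \<le> R / 4" using c by simp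
      moreover have "norm a = 3/4 * R" using R by (simp add: a_def norm_axis_1)
      ultimately show "R / 2 \<le> norm (c *\<^sub>R x + a)" "norm (c *\<^sub>R x + a) \<le> R"
        using norm_triangle_ineq[of "c *\<^sub>R x" a] norm_diff_ineq[of a "c *\<^sub>R x"]
        by (simp_all add: add.commute)
    qed
    have cont: "continuous_on UNIV g" "continuous_on UNIV \<phi>"
      "continuous_on UNIV (?L (?L (?L g)))" "continuous_on UNIV (?L (?L (?L \<phi>)))"
      using Cg \<phi>(1) CLg(3) C\<phi>(3) by (auto intro: Ck_imp_continuous simp del: Ck.simps)
    have "(c ^ 6 * m powr (- q)) * I = (\<integral>x. (c ^ 6 * m powr (- q)) * \<phi> x \<partial>lborel)"
      by (simp add: I_def)
    also have "\<dots> \<le> (\<integral>x. ?L (?L (?L g)) x * \<phi> x \<partial>lborel)"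
    proof (rule integral_mono)
      show "integrable lborel (\<lambda>x. (c ^ 6 * m powr (- q)) * \<phi> x)"
        by (rule integrable_compact_support[of ?Q]) (auto intro!: continuous_intros cont simp: \<phi>(3))
      show "integrable lborel (\<lambda>x. ?L (?L (?L g)) x * \<phi> x)"
        by (rule integrable_compact_support[of ?Q]) (auto intro!: continuous_intros cont simp: \<phi>(3))
      fix x
      show "(c ^ 6 * m powr (- q)) * \<phi> x \<le> ?L (?L (?L g)) x * \<phi> x"
      proof (cases "x \<in> ?Q")
        case True
        let ?y = "c *\<^sub>R x + a"
        have "u ?y \<le> m" by (rule le) (rule ann[OF True])+
        then have "m powr (- q) \<le> u ?y powr (- q)"
          using q u(2)[of ?y] by (intro powr_mono2') auto
        then have "c ^ 6 * m powr (- q) \<le> c ^ 6 * u ?y powr (- q)"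
          using c by (intro mult_left_mono) auto
        also have "\<dots> = ?L (?L (?L g)) x"
          by (simp add: LLLg u(3) power2_eq_square eval_nat_numeral)
        finally show ?thesis using \<phi>(2) by (intro mult_right_mono)
      qed (simp add: \<phi>(3))
    qed
    \<comment> \<open>The three Laplacians pass to the bump function one at a time, each new test
      function still vanishing outside the cube.\<close>
    also have "\<dots> = (\<integral>x. ?L (?L g) x * ?L \<phi> x \<partial>lborel)"
      using integral_laplacian_by_parts[of 0 "?L (?L g)" 4 \<phi> ?Q] CLg(2) \<phi>(1,3)
      by (simp del: Ck.simps add: numeral_2_eq_2)
    also have "\<dots> = (\<integral>x. ?L g x * ?L (?L \<phi>) x \<partial>lborel)"
      using integral_laplacian_by_parts[of 2 "?L g" 2 "?L \<phi>" ?Q] CLg(1) C\<phi>(1) z1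
      by (simp del: Ck.simps)
    also have "\<dots> = (\<integral>x. g x * ?L (?L (?L \<phi>)) x \<partial>lborel)"
      using integral_laplacian_by_parts[of 4 g 0 "?L (?L \<phi>)" ?Q] Cg C\<phi>(2) z2
      by (simp del: Ck.simps add: numeral_2_eq_2)
    also have "\<dots> \<le> (\<integral>x. m * \<bar>?L (?L (?L \<phi>)) x\<bar> \<partial>lborel)"
    proof (rule integral_mono)
      show "integrable lborel (\<lambda>x. g x * ?L (?L (?L \<phi>)) x)"
        by (rule integrable_compact_support[of ?Q]) (auto intro!: continuous_intros cont simp: z3)
      show "integrable lborel (\<lambda>x. m * \<bar>?L (?L (?L \<phi>)) x\<bar>)"
        by (rule integrable_compact_support[of ?Q]) (auto intro!: continuous_intros cont simp: z3)
      fix x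
      show "g x * ?L (?L (?L \<phi>)) x \<le> m * \<bar>?L (?L (?L \<phi>)) x\<bar>"
      proof (cases "x \<in> ?Q")
        case True
        \<comment> \<open>Positivity of \<open>g\<close> allows the test function to be replaced by
          its absolute value before \<open>g x \<le> m\<close> is applied.\<close>
        have "0 < g x" "g x \<le> m" using le[OF ann[OF True]] u(2) by (auto simp: g_def)
        then show ?thesis
          by (intro order.trans[OF _ mult_right_mono[of "g x" m "\<bar>?L (?L (?L \<phi>)) x\<bar>"]] mult_left_mono) auto
      qed (simp add: z3)
    qed
    also have "\<dots> = m * K" by (simp add: K_def)
    \<comment> \<open>Multiplying by \<open>m powr q\<close> collects all powers of \<open>m\<close>
      on the right as \<open>m powr (q + 1)\<close>.\<close>
    finally have "(c ^ 6 * m powr (- q) * I) * m powr q \<le> (m * K) * m powr q"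
      by (rule mult_right_mono) simp
    moreover have "m powr (- q) * m powr q = 1" "m * m powr q = m powr (q + 1)"
      using m by (simp_all add: powr_minus powr_add mult.commute)
    moreover have "(c ^ 6 * m powr (- q) * I) * m powr q = c ^ 6 * I * (m powr (- q) * m powr q)"
      "(m * K) * m powr q = (m * m powr q) * K"
      by (simp_all only: mult_ac)
    ultimately have "c ^ 6 * I \<le> m powr (q + 1) * K" by simp
    \<comment> \<open>The exponent \<open>6 / (q + 1)\<close> is the scale-invariant one:
      \<open>R ^ 6\<close> appears here and in \<open>c ^ 6\<close>, and cancels.\<close>
    also have "m powr (q + 1) = \<epsilon> powr (q + 1) * R ^ 6"
    proof -
      have "(R powr (6 / (q + 1))) powr (q + 1) = R powr 6"
        using q nonzero_mult_div_cancel_right[of "q + 1" 6] unfolding powr_powr times_divide_eq_left by simp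
      also have "\<dots> = R ^ 6" using R by simp
      finally show ?thesis using \<epsilon> R by (simp add: m_def powr_mult)
    qed
    finally have "R ^ 6 * (\<delta> ^ 6 * I) \<le> R ^ 6 * (\<epsilon> powr (q + 1) * K)"
      by (simp add: c_def power_mult_distrib mult_ac)
    then show False using \<epsilon>K R by simp
  qed
  with \<epsilon> show ?thesis by (rule that)
qed

section \<open>Radial functions and their ordinary differential equations\<close>

text \<open>G is the Laplacian of the radial profile F in dimension N + 1. Continuity of F' at 0 makes
  the flux r ^ N * F' r start from 0 when N \<ge> 1.\<close>
definition radial_ode :: "nat \<Rightarrow> (real \<Rightarrow> real) \<Rightarrow> (real \<Rightarrow> real) \<Rightarrow> (real \<Rightarrow> real) \<Rightarrow> bool" where
  "radial_ode N F F' G \<longleftrightarrow>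
    (\<forall>r>0. (F has_real_derivative F' r) (at r)) \<and>
    (\<forall>r>0. ((\<lambda>r. r ^ N * F' r) has_real_derivative r ^ N * G r) (at r)) \<and>
    continuous_on {0..} F'"

lemma DERIV_norm_line:
  fixes x :: "real^'n::finite"
  assumes "x \<noteq> 0"
  shows "((\<lambda>t. norm (x + t *\<^sub>R axis i 1)) has_real_derivative x $ i / norm x) (at 0)"
proof -
  have "norm (x + t *\<^sub>R axis i 1) = sqrt ((norm x)\<^sup>2 + 2 * t * x $ i + t\<^sup>2)" for t
    unfolding norm_eq_sqrt_inner
    by (simp add: inner_axis inner_add_left inner_add_right inner_axis' power2_eq_square algebra_simps
        real_sqrt_mult_self)
  moreover have "((\<lambda>t. sqrt ((norm x)\<^sup>2 + 2 * t * x $ i + t\<^sup>2)) has_real_derivative x $ i / norm x) (at 0)"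
    using assms by (auto intro!: derivative_eq_intros simp: field_simps)
  ultimately show ?thesis by simp
qed

text \<open>The Laplacian comes out radial, with the profile \<open>G\<close>, so the lemma can be
  iterated. Off the origin it is \<open>F'' + N / r * F'\<close> with
  \<open>N = CARD('n) - 1\<close>, which is the flux equation divided by
  \<open>r ^ N\<close>.\<close>

lemma radial_laplacian:
  fixes f :: "real^'n::finite \<Rightarrow> real"
  assumes f: "Ck (k + 2) f" and rad: "\<And>x. f x = F (norm x)"
  obtains F' G where "\<And>x. laplacian f x = G (norm x)" "radial_ode (CARD('n) - 1) F F' G"
proof -
  define i0 :: 'n where "i0 = undefined"
  define e :: "real^'n" where "e = axis i0 1"
  \<comment> \<open>Reading the derivative off a line through the origin keeps it differentiable at
    0, where the norm is not.\<close>
  define F' where "F' r = partial i0 f (r *\<^sub>R e)" for r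
  define F'' where "F'' r = partial i0 (partial i0 f) (r *\<^sub>R e)" for r
  define G where "G r = laplacian f (r *\<^sub>R e)" for r
  have f1: "Ck (Suc (Suc k)) f" "Ck (Suc k) (partial i f)" for i
    using f by auto
  have norm_e: "norm e = 1" by (simp add: e_def norm_axis_1)
  have dF: "(F has_real_derivative F' r) (at r)" if "r > 0" for r
  proof -
    have "((\<lambda>s. f (0 + s *\<^sub>R e)) has_real_derivative partial i0 f (0 + r *\<^sub>R e)) (at r)"
      unfolding e_def by (rule DERIV_line) (rule Ck_DERIV[OF f1(1)])
    moreover have "eventually (\<lambda>s. f (0 + s *\<^sub>R e) = F s) (nhds r)"
      using eventually_nhds_in_open[of "{0<..}" r] that
      by (auto elim!: eventually_mono simp: rad norm_e)
    ultimately show ?thesis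
      by (simp add: F'_def DERIV_cong_ev)
  qed
  have dF': "(F' has_real_derivative F'' r) (at r)" for r
  proof -
    have "((\<lambda>s. partial i0 f (0 + s *\<^sub>R e)) has_real_derivative partial i0 (partial i0 f) (0 + r *\<^sub>R e)) (at r)"
      unfolding e_def by (rule DERIV_line) (rule Ck_DERIV[OF f1(2)])
    then show ?thesis by (simp add: F'_def[abs_def] F''_def)
  qed
  have p1: "partial i f x = F' (norm x) * (x $ i / norm x)" if "x \<noteq> 0" for i x
  proof (rule partialI(2))
    have "((\<lambda>t. F (norm (x + t *\<^sub>R axis i 1))) has_real_derivative F' (norm x) * (x $ i / norm x)) (at 0)"
      using that dF[of "norm x"] by (intro DERIV_chain2[OF _ DERIV_norm_line]) auto
    then show "((\<lambda>t. f (x + t *\<^sub>R axis i 1)) has_real_derivative F' (norm x) * (x $ i / norm x)) (at 0)"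
      by (simp add: rad)
  qed
  have p2: "partial i (partial i f) x =
      F'' (norm x) * (x $ i / norm x)\<^sup>2 + F' (norm x) * (1 / norm x - (x $ i)\<^sup>2 / norm x ^ 3)"
    (is "_ = ?D") if "x \<noteq> 0" for i x
  proof (rule partialI(2))
    let ?l = "\<lambda>t. x + t *\<^sub>R axis i 1"
    have nx: "norm x > 0" using that by simp
    have d1: "((\<lambda>t. F' (norm (?l t))) has_real_derivative F'' (norm x) * (x $ i / norm x)) (at 0)"
      using dF'[of "norm x"] by (intro DERIV_chain2[OF _ DERIV_norm_line[OF that]]) auto
    have d2: "((\<lambda>t. (x $ i + t) / norm (?l t)) has_real_derivative
        (1 * norm x - x $ i * (x $ i / norm x)) / (norm x * norm x)) (at 0)"
    proof -
      have "((\<lambda>t. x $ i + t) has_real_derivative 1) (at 0)"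
        by (auto intro!: derivative_eq_intros)
      from DERIV_divide[OF this DERIV_norm_line[OF that, of i]] show ?thesis using nx by simp
    qed
    have "((\<lambda>t. F' (norm (?l t)) * ((x $ i + t) / norm (?l t))) has_real_derivative ?D) (at 0)"
      using DERIV_mult[OF d1 d2] nx
      by (rule_tac DERIV_cong) (auto simp: field_simps power2_eq_square power3_eq_cube)
    moreover have "eventually (\<lambda>t. F' (norm (?l t)) * ((x $ i + t) / norm (?l t)) = partial i f (?l t)) (nhds 0)"
    proof -
      have "(?l \<longlongrightarrow> x + 0 *\<^sub>R axis i 1) (nhds 0)"
        by (intro tendsto_intros filterlim_ident)
      then have "(?l \<longlongrightarrow> x) (nhds 0)" by simp
      then have "eventually (\<lambda>t. ?l t \<noteq> 0) (nhds 0)"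
        using that by (rule tendsto_imp_eventually_ne)
      then show ?thesis by eventually_elim (simp add: p1)
    qed
    ultimately show "((\<lambda>t. partial i f (?l t)) has_real_derivative ?D) (at 0)"
      by (simp add: DERIV_cong_ev)
  qed
  have lap: "laplacian f x = F'' (norm x) + real (CARD('n) - 1) / norm x * F' (norm x)" if "x \<noteq> 0" for x
  proof -
    have nx: "norm x > 0" using that by simp
    have sq: "(\<Sum>i\<in>UNIV. (x $ i)\<^sup>2) = (norm x)\<^sup>2"
      by (simp add: norm_vec_def L2_set_def sum_nonneg)
    \<comment> \<open>After summation the squares add up to the squared norm, and the coefficient of
      \<open>F'\<close> drops from \<open>n / r\<close> to \<open>(n - 1) / r\<close>.\<close>
    have "laplacian f x = F'' (norm x) / (norm x)\<^sup>2 * (\<Sum>i\<in>UNIV. (x $ i)\<^sup>2)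
        + F' (norm x) * (real CARD('n) / norm x - (\<Sum>i\<in>UNIV. (x $ i)\<^sup>2) / norm x ^ 3)"
      unfolding laplacian_def p2[OF that]
      by (simp add: sum.distrib sum_subtractf sum_distrib_left[symmetric] sum_divide_distrib[symmetric]
          power_divide)
    also have "\<dots> = F'' (norm x) + real (CARD('n) - 1) / norm x * F' (norm x)"
      unfolding sq using nx by (simp add: of_nat_diff field_simps power2_eq_square power3_eq_cube)
    finally show ?thesis .
  qed
  have G: "G r = F'' r + real (CARD('n) - 1) / r * F' r" if "r > 0" for r
    unfolding G_def using that norm_e by (subst lap) auto
  have "laplacian f x = G (norm x)" for x
  proof (cases "x = 0")
    case False
    then show ?thesis by (simp add: lap G)
  qed (simp add: G_def)
  moreover have "radial_ode (CARD('n) - 1) F F' G"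
    unfolding radial_ode_def
  proof (intro conjI allI impI)
    fix r :: real assume r: "r > 0"
    show "(F has_real_derivative F' r) (at r)" using dF r by simp
    show "((\<lambda>r. r ^ (CARD('n) - 1) * F' r) has_real_derivative r ^ (CARD('n) - 1) * G r) (at r)"
    proof (cases "CARD('n) - 1")
      case 0
      then show ?thesis using dF'[of r] G[OF r] by simp
    next
      case (Suc N)
      have "((\<lambda>r. r ^ Suc N * F' r) has_real_derivative
          (real (Suc N) * r ^ N) * F' r + F'' r * r ^ Suc N) (at r)"
        using DERIV_mult[OF DERIV_pow[of "Suc N" r] dF'[of r]] by simp
      then show ?thesis
        unfolding Suc by (rule DERIV_cong) (use r in \<open>simp add: G[OF r, unfolded Suc] field_simps\<close>)
    qed
  next
    show "continuous_on {0..} F'"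
      using dF' by (meson DERIV_isCont continuous_at_imp_continuous_on)
  qed
  ultimately show ?thesis by (rule that)
qed

text \<open>Transfers the results on growing profiles to decreasing ones.\<close>

lemma radial_ode_uminus:
  "radial_ode N F F' G \<Longrightarrow> radial_ode N (\<lambda>r. - F r) (\<lambda>r. - F' r) (\<lambda>r. - G r)"
  unfolding radial_ode_def by (auto intro!: continuous_intros DERIV_minus dest: DERIV_minus)

text \<open>The flux \<open>r ^ N * F' r\<close> is 0 at the origin because
  \<open>N \<ge> 1\<close>, and its derivative \<open>r ^ N * G r\<close> is positive.\<close>

lemma radial_ode_deriv_pos:
  assumes "radial_ode N F F' G" "N \<ge> 1" "\<And>r. r > 0 \<Longrightarrow> G r > 0" "r > 0"
  shows "F' r > 0"
proof -
  have "0 ^ N * F' 0 < r ^ N * F' r"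
  proof (rule DERIV_pos_imp_increasing_open[OF \<open>r > 0\<close>])
    show "\<exists>y. ((\<lambda>r. r ^ N * F' r) has_real_derivative y) (at x) \<and> 0 < y" if "0 < x" "x < r" for x
      using assms that by (intro exI[of _ "x ^ N * G x"]) (auto simp: radial_ode_def)
    show "continuous_on {0..r} (\<lambda>r. r ^ N * F' r)"
      using assms(1) by (auto simp: radial_ode_def intro!: continuous_intros elim: continuous_on_subset)
  qed
  then show ?thesis
    using assms(2,4) by (simp add: zero_less_mult_iff power_0_left split: if_splits)
qed

lemma radial_ode_strict_increasing:
  assumes "radial_ode N F F' G" "N \<ge> 1" "\<And>r. r > 0 \<Longrightarrow> G r > 0" "0 < a" "a < b"
  shows "F a < F b"
proof (rule DERIV_pos_imp_increasing[OF \<open>a < b\<close>])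
  fix x assume "a \<le> x" "x \<le> b"
  then have "x > 0" using assms(4) by simp
  then show "\<exists>y. (F has_real_derivative y) (at x) \<and> 0 < y"
    using radial_ode_deriv_pos[OF assms(1-3)] assms(1) by (auto simp: radial_ode_def)
qed

text \<open>Integrating \<open>G \<ge> \<epsilon>\<close> makes the flux grow at least like
  \<open>r ^ Suc N\<close>, so \<open>F'\<close> grows at least linearly.\<close>

lemma radial_ode_deriv_ge_1:
  assumes ode: "radial_ode N F F' G" and "\<epsilon> > 0" "R > 0" and G: "\<And>r. r \<ge> R \<Longrightarrow> G r \<ge> \<epsilon>"
  shows "eventually (\<lambda>r. F' r \<ge> 1) at_top"
proof -
  \<comment> \<open>With this \<open>c\<close>, the derivative of \<open>c * r ^ Suc N\<close> is
    \<open>\<epsilon> * r ^ N\<close>, so \<open>H\<close> is nondecreasing past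
    \<open>R\<close>.\<close>
  define c where "c = \<epsilon> / real (Suc N)"
  have c: "c > 0" using assms by (simp add: c_def)
  define H where "H r = r ^ N * F' r - c * r ^ Suc N" for r
  have H: "H R \<le> H r" if "r \<ge> R" for r
  proof (rule DERIV_nonneg_imp_nondecreasing[OF that])
    fix x assume x: "R \<le> x" "x \<le> r"
    have "((\<lambda>r. r ^ N * F' r) has_real_derivative x ^ N * G x) (at x)"
      using ode x assms(3) by (auto simp: radial_ode_def)
    moreover have "((\<lambda>r. c * r ^ Suc N) has_real_derivative c * (real (Suc N) * x ^ N)) (at x)"
      using DERIV_cmult[OF DERIV_pow[of "Suc N" x], of c] by simp
    ultimately have "(H has_real_derivative x ^ N * G x - c * (real (Suc N) * x ^ N)) (at x)"
      unfolding H_def[abs_def] by (rule DERIV_diff)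
    moreover have "x ^ N * G x - c * (real (Suc N) * x ^ N) = x ^ N * (G x - \<epsilon>)"
      by (simp add: c_def field_simps)
    moreover have "x ^ N * (G x - \<epsilon>) \<ge> 0"
      using G[OF x(1)] x assms(3) by simp
    ultimately show "\<exists>y. (H has_real_derivative y) (at x) \<and> 0 \<le> y" by auto
  qed
  \<comment> \<open>The threshold gives \<open>c * r - \<bar>H R\<bar> \<ge> 1\<close>; beyond
    radius 1 the factor \<open>r ^ N\<close> is at least 1 and can be divided out.\<close>
  have "F' r \<ge> 1" if r: "r \<ge> max (max R 1) ((1 + \<bar>H R\<bar>) / c)" for r
  proof -
    have r1: "r \<ge> R" "r \<ge> 1" "c * r \<ge> 1 + \<bar>H R\<bar>"
      using r c by (auto simp: field_simps)
    have "r ^ N \<ge> 1" using r1 by simp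
    have "- (\<bar>H R\<bar> * r ^ N) \<le> H R"
      using mult_left_mono[OF \<open>r ^ N \<ge> 1\<close>, of "\<bar>H R\<bar>"] by linarith
    also have "\<dots> \<le> r ^ N * F' r - c * r ^ Suc N" using H[OF r1(1)] by (simp add: H_def)
    finally have "r ^ N * (c * r - \<bar>H R\<bar>) \<le> r ^ N * F' r"
      by (simp add: algebra_simps)
    then have "c * r - \<bar>H R\<bar> \<le> F' r" using \<open>r ^ N \<ge> 1\<close> by simp
    then show ?thesis using r1(3) by linarith
  qed
  then show ?thesis unfolding eventually_at_top_linorder by blast
qed

text \<open>Once \<open>F' \<ge> 1\<close>, the function \<open>F r - r\<close> is nondecreasing, so
  \<open>F\<close> exceeds any prescribed \<open>C\<close>.\<close>

lemma radial_ode_ge: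
  assumes ode: "radial_ode N F F' G" and "\<epsilon> > 0" "R > 0" and G: "\<And>r. r \<ge> R \<Longrightarrow> G r \<ge> \<epsilon>"
  obtains R' where "R' > 0" "\<And>r. r \<ge> R' \<Longrightarrow> F r \<ge> C"
proof -
  obtain S0 where S0: "\<And>r. r \<ge> S0 \<Longrightarrow> F' r \<ge> 1"
    using radial_ode_deriv_ge_1[OF assms] by (auto simp: eventually_at_top_linorder)
  define S where "S = max 1 S0"
  have lin: "F S - S \<le> F r - r" if "r \<ge> S" for r
  proof (rule DERIV_nonneg_imp_nondecreasing[OF that])
    fix x assume "S \<le> x" "x \<le> r"
    then have "x > 0" "F' x \<ge> 1" using S0 by (auto simp: S_def)
    moreover have "((\<lambda>r. F r - r) has_real_derivative F' x - 1) (at x)"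
      using ode \<open>x > 0\<close> by (intro DERIV_diff DERIV_ident) (auto simp: radial_ode_def)
    ultimately show "\<exists>y. ((\<lambda>r. F r - r) has_real_derivative y) (at x) \<and> 0 \<le> y" by auto
  qed
  have "F r \<ge> C" if "r \<ge> max S (C - F S + S)" for r
    using lin[of r] that by auto
  then show ?thesis by (rule that[of "max S (C - F S + S)", rotated]) (auto simp: S_def)
qed

text \<open>The three equations unfold the triharmonic operator: \<open>V\<close>, \<open>W\<close>
  and \<open>G\<close> are the profiles of the first, second and third Laplacian of
  \<open>U\<close>.\<close>

lemma radial_triharmonic_eventually_increasing:
  assumes U: "radial_ode N U U' V" and V: "radial_ode N V V' W" and W: "radial_ode N W W' G"
    and N: "N \<ge> 1" and G: "\<And>r. r > 0 \<Longrightarrow> G r > 0" and pos: "\<And>r. r > 0 \<Longrightarrow> U r > 0"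
  obtains R where "R > 0" "\<And>a b. R \<le> a \<Longrightarrow> a \<le> b \<Longrightarrow> U a \<le> U b"
proof -
  have W_inc: "W a < W b" if "0 < a" "a < b" for a b
    using radial_ode_strict_increasing[OF W N G that] .
  have "\<exists>R>0. \<forall>r\<ge>R. U' r \<ge> 0"
  proof (cases "\<exists>r0>0. W r0 > 0")
    case True
    then obtain r0 where r0: "r0 > 0" "W r0 > 0" by blast
    have "W r \<ge> W r0" if "r \<ge> r0" for r
      using W_inc[of r0 r] r0 that by (cases "r = r0") auto
    then obtain R1 where R1: "R1 > 0" "\<And>r. r \<ge> R1 \<Longrightarrow> V r \<ge> 1"
      using radial_ode_ge[OF V r0(2,1)] by blast
    then have "eventually (\<lambda>r. U' r \<ge> 1) at_top"
      using radial_ode_deriv_ge_1[OF U zero_less_one] by blast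
    then obtain R2 where "\<And>r. r \<ge> R2 \<Longrightarrow> U' r \<ge> 1" by (auto simp: eventually_at_top_linorder)
    then have "\<forall>r\<ge>max 1 R2. U' r \<ge> 0" by force
    then show ?thesis by (intro exI[of _ "max 1 R2"]) auto
  next
    case False
    have W_neg: "- W r > 0" if "r > 0" for r
    proof -
      \<comment> \<open>Looking one unit ahead, strict monotonicity upgrades
        \<open>W \<le> 0\<close> to \<open>W r < 0\<close>.\<close>
      have "W (r + 1) \<le> 0" using False that by (meson add_pos_pos not_less zero_less_one)
      then show ?thesis using W_inc[of r "r + 1"] that by simp
    qed
    have V_dec: "V b < V a" if "0 < a" "a < b" for a b
      using radial_ode_strict_increasing[OF radial_ode_uminus[OF V] N W_neg that] by simp
    have V_pos: "V r > 0" if r: "r > 0" for r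
    proof (rule ccontr)
      assume "\<not> V r > 0"
      then have neg: "V (r + 1) < 0" using V_dec[of r "r + 1"] r by simp
      \<comment> \<open>Past \<open>r + 1\<close>, \<open>- V\<close> stays above a positive
        constant, so \<open>- U\<close> is eventually nonnegative, against
        \<open>U > 0\<close>.\<close>
      have "- V s \<ge> - V (r + 1)" if "s \<ge> r + 1" for s
        using V_dec[of "r + 1" s] r that by (cases "s = r + 1") auto
      then obtain R1 where "R1 > 0" "\<And>s. s \<ge> R1 \<Longrightarrow> - U s \<ge> 0"
        using radial_ode_ge[OF radial_ode_uminus[OF U], of "- V (r + 1)" "r + 1" 0] neg r by auto
      then show False using pos[of R1] by force
    qed
    have "U' r > 0" if "r > 0" for r
      using radial_ode_deriv_pos[OF U N V_pos that] .
    then show ?thesis by (intro exI[of _ 1]) (auto intro!: less_imp_le)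
  qed
  then obtain R where R: "R > 0" "\<And>r. r \<ge> R \<Longrightarrow> U' r \<ge> 0" by blast
  have "U a \<le> U b" if "R \<le> a" "a \<le> b" for a b
  proof (rule DERIV_nonneg_imp_nondecreasing[OF that(2)])
    fix x assume "a \<le> x" "x \<le> b"
    then show "\<exists>y. (U has_real_derivative y) (at x) \<and> 0 \<le> y"
      using R that U by (intro exI[of _ "U' x"]) (auto simp: radial_ode_def)
  qed
  with R(1) show ?thesis by (rule that)
qed

section \<open>Nonexistence under the growth conditions\<close>

theorem mainTheorem7:
  fixes q :: real
  assumes n2: "CARD('n::finite) \<ge> 2"
    and q: "q > 0"
  shows "(\<not> (\<exists>u :: real^'n \<Rightarrow> real.
              Ck 6 u \<and> (\<forall>x. u x > 0) \<and>
              (\<forall>x. laplacian (laplacian (laplacian u)) x = u x powr (- q)) \<and>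
              u \<in> o[at_infinity](\<lambda>x. norm x powr (6 / (q + 1)))) \<and>
         \<not> (\<exists>v :: real \<Rightarrow> real.
              let u = (\<lambda>x :: real^'n. v (norm x)) in
              Ck 6 u \<and> (\<forall>x. u x > 0) \<and>
              (\<forall>x. laplacian (laplacian (laplacian u)) x = u x powr (- q)) \<and>
              Limsup at_top (\<lambda>r. ereal (v r / r powr (6 / (q + 1)))) < \<infinity> \<and>
              Liminf at_top (\<lambda>r. ereal (v r / r powr (6 / (q + 1)))) = 0))"
proof -
  define \<alpha> where "\<alpha> = 6 / (q + 1)"
  have \<alpha>: "\<alpha> > 0" using q by (simp add: \<alpha>_def)
  obtain \<epsilon> where \<epsilon>: "\<epsilon> > 0"
    and lower: "\<And>(u :: real^'n \<Rightarrow> real) R. Ck 6 u \<Longrightarrow> (\<And>x. u x > 0) \<Longrightarrow>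
      (\<And>x. laplacian (laplacian (laplacian u)) x = u x powr (- q)) \<Longrightarrow> R > 0 \<Longrightarrow>
      \<exists>x. R / 2 \<le> norm x \<and> norm x \<le> R \<and> u x > \<epsilon> * R powr \<alpha>"
    unfolding \<alpha>_def using annulus_lower_bound[OF q] by blast
  have False if u: "Ck 6 u" "\<And>x. u x > 0" "\<And>x. laplacian (laplacian (laplacian u)) x = u x powr (- q)"
    and o: "u \<in> o[at_infinity](\<lambda>x. norm x powr \<alpha>)" for u :: "real^'n \<Rightarrow> real"
  proof -
    have "eventually (\<lambda>x. norm (u x) \<le> \<epsilon> * norm (norm x powr \<alpha>)) at_infinity"
      using landau_o.smallD[OF o \<epsilon>] .
    then obtain b where b: "\<And>x. norm x \<ge> b \<Longrightarrow> \<bar>u x\<bar> \<le> \<epsilon> * norm x powr \<alpha>"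
      by (auto simp: eventually_at_infinity)
    \<comment> \<open>The inner radius \<open>max b 1\<close> places the annulus where the little-o
      bound holds and keeps the outer radius positive.\<close>
    obtain x where x: "max b 1 \<le> norm x" "norm x \<le> 2 * max b 1" "u x > \<epsilon> * (2 * max b 1) powr \<alpha>"
      using lower[OF u, of "2 * max b 1"] by auto
    have "u x \<le> \<epsilon> * norm x powr \<alpha>" using b[of x] x(1) by simp
    also have "\<dots> \<le> \<epsilon> * (2 * max b 1) powr \<alpha>"
      using \<epsilon> \<alpha> x(2) by (intro mult_left_mono powr_mono2) auto
    finally show False using x(3) by simp
  qed
  moreover have False if u: "Ck 6 (\<lambda>x :: real^'n. v (norm x))" "\<And>x :: real^'n. v (norm x) > 0"
    "\<And>x :: real^'n. laplacian (laplacian (laplacian (\<lambda>x. v (norm x)))) x = v (norm x) powr (- q)"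
    and liminf: "Liminf at_top (\<lambda>r. ereal (v r / r powr \<alpha>)) = 0" for v
  proof -
    let ?u = "\<lambda>x :: real^'n. v (norm x)"
    have C: "Ck (4 + 2) ?u" "Ck (2 + 2) (laplacian ?u)" "Ck (0 + 2) (laplacian (laplacian ?u))"
      using u(1) Ck_6_laplacian[OF u(1)]
      by (simp, simp, simp del: Ck.simps add: numeral_2_eq_2)
    \<comment> \<open>Each profile obtained is fed into the next application, giving the chain
      \<open>v\<close>, \<open>V\<close>, \<open>W\<close>, \<open>G\<close>.\<close>
    obtain v' V where V: "\<And>x. laplacian ?u x = V (norm x)" "radial_ode (CARD('n) - 1) v v' V"
      using radial_laplacian[OF C(1), of v] by blast
    obtain V' W where W: "\<And>x. laplacian (laplacian ?u) x = W (norm x)" "radial_ode (CARD('n) - 1) V V' W"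
      using radial_laplacian[OF C(2) V(1)] by blast
    obtain W' G where G: "\<And>x. laplacian (laplacian (laplacian ?u)) x = G (norm x)"
      "radial_ode (CARD('n) - 1) W W' G"
      using radial_laplacian[OF C(3) W(1)] by blast
    have ex: "\<exists>x :: real^'n. norm x = r" if "r > 0" for r
      using vector_choose_size[of r] that by auto
    have v_pos: "v r > 0" if "r > 0" for r
      using ex[OF that] u(2) by auto
    have G_pos: "G r > 0" if "r > 0" for r
    proof -
      obtain x :: "real^'n" where "norm x = r" using ex[OF \<open>r > 0\<close>] by blast
      then have "G r = v r powr (- q)" using u(3)[of x] G(1)[of x] by simp
      then show ?thesis using v_pos[OF \<open>r > 0\<close>] by simp
    qed
    \<comment> \<open>Dimension at least two supplies \<open>N \<ge> 1\<close>, which makes the flux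
      vanish at the origin.\<close>
    have "CARD('n) - 1 \<ge> 1" using n2 by simp
    then obtain R where R: "R > 0" "\<And>a b. R \<le> a \<Longrightarrow> a \<le> b \<Longrightarrow> v a \<le> v b"
      using radial_triharmonic_eventually_increasing[OF V(2) W(2) G(2) _ G_pos v_pos] by blast
    \<comment> \<open>A zero lower limit gives such radii arbitrarily far out;
      \<open>r \<ge> 2 * R\<close> keeps the annulus from \<open>r / 2\<close> to \<open>r\<close>
      inside the range of monotonicity.\<close>
    have "\<exists>r\<ge>2 * R. v r / r powr \<alpha> < \<epsilon>"
    proof (rule ccontr)
      assume "\<not> ?thesis"
      then have "eventually (\<lambda>r. ereal \<epsilon> \<le> ereal (v r / r powr \<alpha>)) at_top"
        by (auto simp: eventually_at_top_linorder not_less)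
      then have "ereal \<epsilon> \<le> Liminf at_top (\<lambda>r. ereal (v r / r powr \<alpha>))"
        by (rule Liminf_bounded)
      then show False using liminf \<epsilon> by simp
    qed
    then obtain r where r: "r \<ge> 2 * R" "v r / r powr \<alpha> < \<epsilon>" by blast
    have "r > 0" using r R by linarith
    then obtain x :: "real^'n" where x: "r / 2 \<le> norm x" "norm x \<le> r" "v (norm x) > \<epsilon> * r powr \<alpha>"
      using lower[OF u, of r] by auto
    have "v (norm x) \<le> v r" using R(2)[of "norm x" r] x r by simp
    also have "\<dots> < \<epsilon> * r powr \<alpha>" using r(2) \<open>r > 0\<close> by (simp add: field_simps)
    finally show False using x(3) by simp
  qed
  ultimately show ?thesis
    unfolding Let_def \<alpha>_def by blast
qed

end
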